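(* Let $\mathsf L$ and $\mathsf T$ be closed linear operators in a complex Hilbert space $(\mathcal H,\langle\cdot,\cdot\rangle)$ with norm $\|\cdot\|$, with $\mathsf L$ Hermitian and $\mathsf T$ anti-Hermitian. Let $\Pi$ be the orthogonal projection onto the null space of $\mathsf L$ and let $\mathsf A:=\big(\mathrm{Id}+(\mathsf T\Pi)^*\mathsf T\Pi\big)^{-1}(\mathsf T\Pi)^*$. Assume that there are positive constants $\lambda_m$, $\lambda_M$, $C_M$ such that, for all $F\in\mathcal H$, $$-\langle\mathsf LF,F\rangle\ge\lambda_m\|(\mathrm{Id}-\Pi)F\|^2,\qquad \|\mathsf T\Pi F\|^2\ge\lambda_M\|\Pi F\|^2,\qquad \Pi\mathsf T\Pi F=0,$$ $$\|\mathsf{AT}(\mathrm{Id}-\Pi)F\|+\|\mathsf{AL}F\|\le C_M\|(\mathrm{Id}-\Pi)F\|.$$ For $\delta>0$ let $\mathsf H_1[F]:=\frac12\|F\|^2+\delta\,\mathrm{Re}\langle\mathsf AF,F\rangle$. With $\delta_\star$, $\lambda_\star(\delta)$ and $C_\star(\delta)$ as defined in the context, the following holds for any solution $F$ of $\frac{dF}{dt}+\mathsf TF=\mathsf LF$, $t>0$, with initial datum $F_0\in\mathcal H$. (1) With $\lambda:=\max\{\lambda_\star(\delta):\delta\in(0,\delta_\star)\}$, and with the parameter $\delta\in(0,\delta_\star)$ in $\mathsf H_1$ chosen such that this maximum is attained, $$\mathsf H_1[F(t,\cdot)]\le\mathsf H_1[F_0]\,e^{-\lambda t}\quad\text{for all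 }t\ge0.$$ (2) For any $\delta$ with $0<\delta<\min\{2,\delta_\star\}$, $$\|F(t)\|^2\le C_\star(\delta)\,e^{-\lambda_\star(\delta)\,t}\,\|F_0\|^2\quad\text{for all }t\ge0.$$
   Context: Standing convention: the evolution equation has the unique steady state $F_\infty=0$ (otherwise $F$ and $F_0$ are replaced by $F-F_\infty$ and $F_0-F_\infty$). The operators may be unbounded; the inequalities are understood whenever the expressions make sense. Notation: $\mathcal T_m:=\{(\delta,\lambda)\in(0,\lambda_m)\times(0,2\lambda_m):\lambda<2(\lambda_m-\delta)\}$. On $\mathcal T_m$ define $$h_\star(\delta,\lambda):=\delta^2\Big(C_M+\frac\lambda2\Big)^2-4\Big(\lambda_m-\delta-\frac\lambda2\Big)\Big(\frac{\delta\lambda_M}{1+\lambda_M}-\frac\lambda2\Big).$$ Moreover $K_M:=\frac{\lambda_M}{1+\lambda_M}$, $\delta_\star:=\frac{4K_M\lambda_m}{4K_M+C_M^2}<\lambda_m$, and $$\lambda_\star(\delta):=\sup\{\lambda>0:(\delta,\lambda)\in\mathcal T_m,\ h_\star(\delta,\lambda)\le0\},\qquad C_\star(\delta):=\frac{2+\delta}{2-\delta}.$$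
   Formalization: Solutions F are required to satisfy ΠF(t) ∈ D(T) for t>0 (besides F(t) ∈ D(L)∩D(T)), or to be locally uniform limits of such solutions, and TΠ is assumed densely defined; without the condition on ΠF(t) the claim fails for some unbounded T. *)

theory Defs
  imports "HOL-Analysis.Analysis"
begin

(* Complex Hilbert spaces. The inner product is linear in its first argument. The topology, the
   norm and completeness are those of the underlying real Hilbert space, whose inner product is
   the real part of the complex one. *)
class chilbert_space = real_inner + complete_space +
  fixes scaleC :: "complex \<Rightarrow> 'a \<Rightarrow> 'a"  (infixr "*\<^sub>C" 75)
    and cinner :: "'a \<Rightarrow> 'a \<Rightarrow> complex"
  assumes scaleC_add_right: "c *\<^sub>C (x + y) = c *\<^sub>C x + c *\<^sub>C y"
    and scaleC_add_left: "(c + d) *\<^sub>C x = c *\<^sub>C x + d *\<^sub>C x"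
    and scaleC_scaleC: "c *\<^sub>C d *\<^sub>C x = (c * d) *\<^sub>C x"
    and scaleC_of_real: "complex_of_real r *\<^sub>C x = r *\<^sub>R x"
    and cinner_commute: "cinner x y = cnj (cinner y x)"
    and cinner_add_left: "cinner (x + y) z = cinner x z + cinner y z"
    and cinner_scaleC_left: "cinner (c *\<^sub>C x) y = c * cinner x y"
    and inner_eq_Re_cinner: "inner x y = Re (cinner x y)"

instantiation complex :: chilbert_space
begin

definition scaleC_complex :: "complex \<Rightarrow> complex \<Rightarrow> complex"
  where "scaleC_complex c x = c * x"

definition cinner_complex :: "complex \<Rightarrow> complex \<Rightarrow> complex"
  where "cinner_complex x y = x * cnj y"

instance
  by standard
    (auto simp: scaleC_complex_def cinner_complex_def inner_complex_def algebra_simps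
      scaleR_conv_of_real)

end

(* A possibly unbounded operator is a partial function; its domain of definition is dom. *)
type_synonym 'a pop = "'a \<rightharpoonup> 'a"

definition linear_op :: "'a::chilbert_space pop \<Rightarrow> bool" where
  "linear_op S \<longleftrightarrow> S 0 = Some 0
    \<and> (\<forall>x y u v. S x = Some u \<longrightarrow> S y = Some v \<longrightarrow> S (x + y) = Some (u + v))
    \<and> (\<forall>c x u. S x = Some u \<longrightarrow> S (c *\<^sub>C x) = Some (c *\<^sub>C u))"

definition closed_op :: "'a::chilbert_space pop \<Rightarrow> bool" where
  "closed_op S \<longleftrightarrow> closed (Map.graph S)"

definition densely_defined :: "'a::chilbert_space pop \<Rightarrow> bool" where
  "densely_defined S \<longleftrightarrow> closure (dom S) = UNIV"

definition hermitian_op :: "'a::chilbert_space pop \<Rightarrow> bool" where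
  "hermitian_op S \<longleftrightarrow>
    (\<forall>x y u v. S x = Some u \<longrightarrow> S y = Some v \<longrightarrow> cinner u y = cinner x v)"

definition antihermitian_op :: "'a::chilbert_space pop \<Rightarrow> bool" where
  "antihermitian_op S \<longleftrightarrow>
    (\<forall>x y u v. S x = Some u \<longrightarrow> S y = Some v \<longrightarrow> cinner u y = - cinner x v)"

definition op_of_graph :: "('a \<times> 'a) set \<Rightarrow> 'a pop" where
  "op_of_graph R x = (if \<exists>!y. (x, y) \<in> R then Some (THE y. (x, y) \<in> R) else None)"

(* The usual Hilbert adjoint if S is densely defined; nowhere defined otherwise. *)
definition adjoint_op :: "'a::chilbert_space pop \<Rightarrow> 'a pop" where
  "adjoint_op S = op_of_graph {(y, z). \<forall>x u. S x = Some u \<longrightarrow> cinner u y = cinner x z}"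

definition inverse_op :: "'a pop \<Rightarrow> 'a pop" where
  "inverse_op S = op_of_graph ((Map.graph S)\<inverse>)"

definition closure_op :: "'a::chilbert_space pop \<Rightarrow> 'a pop" where
  "closure_op S = op_of_graph (closure (Map.graph S))"

definition plus_op :: "'a::chilbert_space pop \<Rightarrow> 'a pop \<Rightarrow> 'a pop" where
  "plus_op R S x = (case (R x, S x) of (Some u, Some v) \<Rightarrow> Some (u + v) | _ \<Rightarrow> None)"

definition orth_proj :: "'a::chilbert_space set \<Rightarrow> 'a \<Rightarrow> 'a" where
  "orth_proj M x = (THE y. y \<in> M \<and> (\<forall>z\<in>M. cinner (x - y) z = 0))"

definition null_space :: "'a::chilbert_space pop \<Rightarrow> 'a set" where
  "null_space L = {x. L x = Some 0}"

definition null_proj :: "'a::chilbert_space pop \<Rightarrow> 'a \<Rightarrow> 'a" where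
  "null_proj L = orth_proj (null_space L)"

(* The composition (Id + B* B)^(-1) B* with B = T Pi is a priori only defined on the domain of B*,
   which is dense if B is closed and densely defined; on that domain it is bounded. As usual, A
   denotes its continuous extension to the whole space, that is, its closure. *)
definition A_op :: "'a::chilbert_space pop \<Rightarrow> 'a pop \<Rightarrow> 'a pop" where
  "A_op L T = (let B = T \<circ> null_proj L in
     closure_op (inverse_op (plus_op Some (adjoint_op B \<circ>\<^sub>m B)) \<circ>\<^sub>m adjoint_op B))"

definition H1 :: "'a::chilbert_space pop \<Rightarrow> 'a pop \<Rightarrow> real \<Rightarrow> 'a \<Rightarrow> real" where
  "H1 L T \<delta> F = 1/2 * (norm F)\<^sup>2 + \<delta> * Re (cinner (the (A_op L T F)) F)"

(* The values of the solution are required to lie in the domains of L, T and T Pi (hence also of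
   T (Id - Pi)), so that the coercivity and boundedness expressions make sense along it. *)
definition classical_solution ::
    "'a::chilbert_space pop \<Rightarrow> 'a pop \<Rightarrow> (real \<Rightarrow> 'a) \<Rightarrow> bool" where
  "classical_solution L T F \<longleftrightarrow> continuous_on {0..} F
    \<and> (\<forall>t>0. null_proj L (F t) \<in> dom T
        \<and> (\<exists>u v w. L (F t) = Some u \<and> T (F t) = Some v
            \<and> (F has_vector_derivative w) (at t) \<and> w + v = u))"

(* Locally uniform limits of classical solutions (in particular, classical solutions) are admitted,
   because a classical solution need not exist for every initial datum in the Hilbert space. *)
definition solution :: "'a::chilbert_space pop \<Rightarrow> 'a pop \<Rightarrow> (real \<Rightarrow> 'a) \<Rightarrow> bool" where
  "solution L T F \<longleftrightarrow> (\<exists>G. (\<forall>n::nat. classical_solution L T (G n))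
    \<and> (\<forall>s. uniform_limit {0..s} G F sequentially))"

definition T_region :: "real \<Rightarrow> (real \<times> real) set" where
  "T_region lm = {(\<delta>, lam). \<delta> \<in> {0<..<lm} \<and> lam \<in> {0<..<2 * lm} \<and> lam < 2 * (lm - \<delta>)}"

definition h_star :: "real \<Rightarrow> real \<Rightarrow> real \<Rightarrow> real \<Rightarrow> real \<Rightarrow> real" where
  "h_star lm lM CM \<delta> lam = \<delta>\<^sup>2 * (CM + lam/2)\<^sup>2
     - 4 * (lm - \<delta> - lam/2) * (\<delta> * lM / (1 + lM) - lam/2)"

definition K_M :: "real \<Rightarrow> real" where
  "K_M lM = lM / (1 + lM)"

definition delta_star :: "real \<Rightarrow> real \<Rightarrow> real \<Rightarrow> real" where
  "delta_star lm lM CM = 4 * K_M lM * lm / (4 * K_M lM + CM\<^sup>2)"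

definition lambda_star :: "real \<Rightarrow> real \<Rightarrow> real \<Rightarrow> real \<Rightarrow> real" where
  "lambda_star lm lM CM \<delta> = Sup {lam. lam > 0 \<and> (\<delta>, lam) \<in> T_region lm \<and> h_star lm lM CM \<delta> lam \<le> 0}"

definition C_star :: "real \<Rightarrow> real" where
  "C_star \<delta> = (2 + \<delta>) / (2 - \<delta>)"

end

theory Submission
  imports Defs
begin

text \<open>
  The skew part \<open>T\<close> of the evolution is invisible in the derivative of \<open>\<parallel>F\<parallel>\<^sup>2 / 2\<close>, and the Hermitian
  part \<open>L\<close> only damps the microscopic component \<open>F - P F\<close>, where \<open>P\<close> is the projection onto the null
  space of \<open>L\<close>. Decay of the whole of \<open>F\<close> comes from \<open>T\<close> transporting the macroscopic component
  \<open>P F\<close> into the microscopic one. The entropy \<open>H1\<close> makes this visible: the derivative of its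
  correction \<open>\<delta> Re \<langle>A F, F\<rangle>\<close> contains \<open>- \<delta> \<langle>A T P F, F\<rangle>\<close>, which damps \<open>P F\<close> at the rate
  \<open>lM / (1 + lM)\<close> (\<open>macroscopic_coercivity\<close>), and the remaining terms are controlled by the
  microscopic damping when \<open>\<delta>\<close> is small (\<open>entropy_dissipation\<close>). With \<open>X = \<parallel>F - P F\<parallel>\<close> and
  \<open>Y = \<parallel>P F\<parallel>\<close>, the inequality \<open>H1' \<le> - lam H1\<close> becomes the nonnegativity of a quadratic form in
  \<open>(X, Y)\<close>, whose discriminant is \<open>h_star\<close> (\<open>entropy_decay_rate\<close>). Hence every \<open>lam\<close> with
  \<open>h_star \<le> 0\<close> in the region of parameters is a decay rate, and by continuity so is their supremum
  \<open>lambda_star\<close>. The norm estimate follows as \<open>H1\<close> lies between \<open>(2 - \<delta>) / 4 \<parallel>F\<parallel>\<^sup>2\<close> and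
  \<open>(2 + \<delta>) / 4 \<parallel>F\<parallel>\<^sup>2\<close> (\<open>H1_norm_equivalence\<close>).

  The operators are unbounded, so it has to be shown first that \<open>A\<close>, the closure of
  \<open>(1 + B\<^sup>* B)\<^sup>-\<^sup>1 B\<^sup>*\<close> with \<open>B = T P\<close>, is everywhere defined and bounded. The proof avoids the theory
  of self-adjoint operators: \<open>(A F, B A F)\<close> is the orthogonal projection of \<open>(0, F)\<close> onto the graph
  of \<open>B\<close> in the product space, which exists as \<open>B\<close> is closed (\<open>graph_decomposition\<close>,
  \<open>closure_reg_adjoint\<close>). The bounds on \<open>A\<close> derived here all come from the normal
  equation \<open>A F = B\<^sup>* (F - B A F)\<close> of this projection.

  That an optimal \<open>\<delta>\<close> exists is a compactness argument in the plane of parameters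
  (\<open>lambda_star_attains_max\<close>).
\<close>

section \<open>Orthogonal projections\<close>

text \<open>The first variation of the distance: the competitor used is the projection of \<open>r\<close> off the line
  through \<open>z\<close>, which shortens \<open>r\<close> unless \<open>r\<close> and \<open>z\<close> are already orthogonal.\<close>

lemma closest_vector_orthogonal:
  fixes r z :: "'a::real_inner"
  assumes min: "\<And>c::real. norm r \<le> norm (r - c *\<^sub>R z)"
  shows "inner r z = 0"
proof (cases "z = 0")
  case False
  (* the coefficient of the projection of r onto the line through z *)
  define c where "c = inner r z / (norm z)\<^sup>2"
  have "(norm r)\<^sup>2 \<le> (norm (r - c *\<^sub>R z))\<^sup>2"
    using min by (simp add: power_mono)
  also have "\<dots> = (norm r)\<^sup>2 - 2 * c * inner r z + c\<^sup>2 * (norm z)\<^sup>2"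
    unfolding power2_norm_eq_inner
    by (simp add: inner_diff_left inner_diff_right inner_commute algebra_simps power2_eq_square)
  also have "\<dots> = (norm r)\<^sup>2 - (inner r z)\<^sup>2 / (norm z)\<^sup>2"
    using False by (simp add: c_def field_simps power2_eq_square)
  finally have "(inner r z)\<^sup>2 / (norm z)\<^sup>2 \<le> 0"
    by simp
  then show ?thesis
    using False by (simp add: divide_le_0_iff)
qed simp

text \<open>By the parallelogram law, near-minimizers of the distance to \<open>x\<close> in \<open>M\<close> are close to each
  other. The sets \<open>S n\<close> of near-minimizers are therefore nested closed sets of vanishing diameter, and
  completeness provides their common point. Only the real inner product is involved, so that the lemma
  also applies to the graph of an operator in the product space.\<close>

lemma projection_exists:
  fixes x :: "'a::{real_inner,complete_space}"
  assumes M: "subspace M" "closed M"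
  shows "\<exists>y\<in>M. \<forall>z\<in>M. inner (x - y) z = 0"
proof -
  define d where "d = infdist x M"
  define S where "S n = M \<inter> cball x (d + inverse (Suc n))" for n :: nat
  have ne: "M \<noteq> {}"
    using subspace_0[OF M(1)] by auto
  have d_le: "d \<le> norm (x - y)" if "y \<in> M" for y
    using infdist_le[OF that, of x] by (simp add: d_def dist_norm)
  have d0: "d \<ge> 0"
    by (simp add: d_def infdist_nonneg)
  have S_diam: "(dist y z)\<^sup>2 \<le> 8 * d * inverse (Suc n) + 4 * (inverse (Suc n))\<^sup>2"
    if "y \<in> S n" "z \<in> S n" for y z n
  proof -
    have yz: "y \<in> M" "z \<in> M" "norm (x - y) \<le> d + inverse (Suc n)" "norm (x - z) \<le> d + inverse (Suc n)"
      using that by (auto simp: S_def dist_norm)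
    (* the midpoint of two near-minimizers cannot be closer to x than d *)
    have "(1/2) *\<^sub>R (y + z) \<in> M"
      using yz M(1) by (intro subspace_scale subspace_add)
    then have "d \<le> norm (x - (1/2) *\<^sub>R (y + z))"
      by (rule d_le)
    then have "d\<^sup>2 \<le> (norm (x - (1/2) *\<^sub>R (y + z)))\<^sup>2"
      using d0 by (simp add: power_mono)
    moreover have "(dist y z)\<^sup>2 = 2 * (norm (x - y))\<^sup>2 + 2 * (norm (x - z))\<^sup>2
        - 4 * (norm (x - (1/2) *\<^sub>R (y + z)))\<^sup>2"
      by (simp add: dist_norm power2_norm_eq_inner inner_diff_left inner_diff_right
          inner_add_left inner_add_right inner_commute algebra_simps)
    moreover have "(norm (x - y))\<^sup>2 \<le> (d + inverse (Suc n))\<^sup>2" "(norm (x - z))\<^sup>2 \<le> (d + inverse (Suc n))\<^sup>2"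
      using yz by (simp_all add: power_mono)
    ultimately show ?thesis
      by (simp add: power2_sum)
  qed
  obtain y where y: "\<And>n. y \<in> S n"
  proof (rule decreasing_closed_nest[of S])
    show "closed (S n)" for n
      using M by (simp add: S_def closed_Int)
    show "S n \<noteq> {}" for n
    proof -
      have "infdist x M < d + inverse (Suc n)"
        by (simp add: d_def)
      then have "\<exists>y\<in>M. dist x y < d + inverse (Suc n)"
        using ne by (subst (asm) infdist_notempty) (auto simp: cINF_less_iff)
      then show ?thesis
        by (force simp: S_def)
    qed
    show "S n \<subseteq> S m" if "m \<le> n" for m n
    proof -
      have "inverse (real (Suc n)) \<le> inverse (real (Suc m))"
        using that by (simp add: le_imp_inverse_le)
      then show ?thesis
        unfolding S_def by (intro Int_mono order_refl subset_cball) linarith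
    qed
    show "\<exists>n. \<forall>y\<in>S n. \<forall>z\<in>S n. dist y z < e" if "e > 0" for e
    proof -
      have "(\<lambda>n. 8 * d * inverse (real (Suc n)) + 4 * (inverse (real (Suc n)))\<^sup>2) \<longlonglongrightarrow> 8 * d * 0 + 4 * 0\<^sup>2"
        by (intro tendsto_intros LIMSEQ_inverse_real_of_nat)
      then have "eventually (\<lambda>n. 8 * d * inverse (real (Suc n)) + 4 * (inverse (real (Suc n)))\<^sup>2 < e\<^sup>2) sequentially"
        using \<open>e > 0\<close> by (intro order_tendstoD(2)) auto
      then obtain n where "8 * d * inverse (real (Suc n)) + 4 * (inverse (real (Suc n)))\<^sup>2 < e\<^sup>2"
        by (auto simp: eventually_sequentially)
      then have "(dist y z)\<^sup>2 < e\<^sup>2" if "y \<in> S n" "z \<in> S n" for y z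
        using S_diam[OF that] by linarith
      then show ?thesis
        using \<open>e > 0\<close> power_less_imp_less_base by (metis less_imp_le)
    qed
  qed blast
  have "y \<in> M"
    using y[of 0] by (simp add: S_def)
  have "norm (x - y) \<le> d"
  proof (rule LIMSEQ_le_const)
    show "(\<lambda>n. d + inverse (real (Suc n))) \<longlonglongrightarrow> d"
      using tendsto_add[OF tendsto_const LIMSEQ_inverse_real_of_nat, of d] by simp
    show "\<exists>N. \<forall>n\<ge>N. norm (x - y) \<le> d + inverse (real (Suc n))"
      using y by (auto simp: S_def dist_norm)
  qed
  then have "norm (x - y) \<le> norm (x - y - c *\<^sub>R z)" if "z \<in> M" for z c
    using d_le[of "y + c *\<^sub>R z"] that \<open>y \<in> M\<close> M(1)
    by (simp add: subspace_add subspace_scale diff_diff_eq)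
  then show ?thesis
    using \<open>y \<in> M\<close> closest_vector_orthogonal by blast
qed

section \<open>The complex inner product\<close>

lemma cinner_add_right: "cinner x (y + z) = cinner x y + cinner x (z::'a::chilbert_space)"
  by (metis cinner_add_left cinner_commute complex_cnj_add)

lemma cinner_scaleC_right: "cinner x (c *\<^sub>C y) = cnj c * cinner x (y::'a::chilbert_space)"
  by (metis cinner_commute cinner_scaleC_left complex_cnj_mult)

lemma scaleC_zero: "c *\<^sub>C 0 = (0::'a::chilbert_space)"
  using scaleC_add_right[of c 0 "0::'a"] by simp

lemma scaleC_minus_one: "(-1) *\<^sub>C x = - (x::'a::chilbert_space)"
  using scaleC_of_real[of "-1" x] by simp

lemma cinner_minus_left: "cinner (- x) y = - cinner x (y::'a::chilbert_space)"
  by (metis scaleC_minus_one cinner_scaleC_left mult_minus1)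

lemma cinner_minus_right: "cinner x (- y) = - cinner x (y::'a::chilbert_space)"
  by (metis cinner_minus_left cinner_commute complex_cnj_minus)

lemma cinner_diff_left: "cinner (x - y) z = cinner x z - cinner y (z::'a::chilbert_space)"
  by (metis cinner_add_left cinner_minus_left diff_conv_add_uminus)

lemma cinner_diff_right: "cinner x (y - z) = cinner x y - cinner x (z::'a::chilbert_space)"
  by (metis cinner_add_right cinner_minus_right diff_conv_add_uminus)

lemma cinner_zero_left [simp]: "cinner 0 (y::'a::chilbert_space) = 0"
  using cinner_diff_left[of 0 0 y] by simp

lemma cinner_zero_right [simp]: "cinner (y::'a::chilbert_space) 0 = 0"
  using cinner_diff_right[of y 0 0] by simp

text \<open>The norm and the projections live in the underlying real Hilbert space. On complex subspaces
  real orthogonality already is complex orthogonality, as multiplication by \<open>\<i>\<close> turns the imaginary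
  part of the inner product into a real part.\<close>

lemma cinner_eq_0_if_inner_eq_0:
  fixes x :: "'a::chilbert_space"
  assumes "\<And>c. inner (c *\<^sub>C x) y = 0"
  shows "cinner x y = 0"
  using assms[of 1] assms[of \<i>]
  by (simp add: inner_eq_Re_cinner cinner_scaleC_left complex_eq_iff)

definition csubspace :: "'a::chilbert_space set \<Rightarrow> bool" where
  "csubspace M \<longleftrightarrow> 0 \<in> M \<and> (\<forall>x\<in>M. \<forall>y\<in>M. x + y \<in> M) \<and> (\<forall>c. \<forall>x\<in>M. c *\<^sub>C x \<in> M)"

lemma csubspace_imp_subspace: "csubspace M \<Longrightarrow> subspace M"
  unfolding csubspace_def subspace_def by (metis scaleC_of_real)

lemma orth_proj_unique:
  fixes x :: "'a::chilbert_space"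
  assumes M: "csubspace M" and y: "y \<in> M" "\<forall>z\<in>M. cinner (x - y) z = 0"
  shows "orth_proj M x = y"
  unfolding orth_proj_def
proof (rule the_equality)
  fix y' assume y': "y' \<in> M \<and> (\<forall>z\<in>M. cinner (x - y') z = 0)"
  have "y - y' \<in> M"
    using y y' M by (simp add: csubspace_imp_subspace subspace_diff)
  then have "cinner (x - y') (y - y') - cinner (x - y) (y - y') = 0"
    using y y' by simp
  then have "inner (y - y') (y - y') = 0"
    by (simp add: inner_eq_Re_cinner flip: cinner_diff_left)
  then show "y' = y"
    by simp
qed (use y in auto)

lemma
  fixes x :: "'a::chilbert_space"
  assumes M: "csubspace M" "closed M"
  shows orth_proj_mem: "orth_proj M x \<in> M"
    and orth_proj_orthogonal: "\<And>z. z \<in> M \<Longrightarrow> cinner (x - orth_proj M x) z = 0"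
proof -
  obtain y where y: "y \<in> M" "\<forall>z\<in>M. inner (x - y) z = 0"
    using projection_exists[OF csubspace_imp_subspace[OF M(1)] M(2)] by blast
  have "cinner z (x - y) = 0" if "z \<in> M" for z
  proof (rule cinner_eq_0_if_inner_eq_0)
    show "inner (c *\<^sub>C z) (x - y) = 0" for c
      using y that M(1) by (metis csubspace_def inner_commute)
  qed
  then have "\<forall>z\<in>M. cinner (x - y) z = 0"
    by (metis cinner_commute complex_cnj_zero)
  with orth_proj_unique[OF M(1) y(1)] y(1)
  show "orth_proj M x \<in> M" "\<And>z. z \<in> M \<Longrightarrow> cinner (x - orth_proj M x) z = 0"
    by auto
qed

lemma orth_proj_inner:
  fixes x z :: "'a::chilbert_space"
  assumes M: "csubspace M" "closed M" and z: "z \<in> M"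
  shows "inner (orth_proj M x) z = inner x z"
  using orth_proj_orthogonal[OF assms] by (simp add: cinner_diff_left inner_eq_Re_cinner)

lemma orth_proj_fixed: "csubspace M \<Longrightarrow> x \<in> M \<Longrightarrow> orth_proj M x = x"
  by (rule orth_proj_unique) auto

lemma orth_proj_scaleC:
  fixes x :: "'a::chilbert_space"
  assumes M: "csubspace M" "closed M"
  shows "orth_proj M (c *\<^sub>C x) = c *\<^sub>C orth_proj M x"
proof (rule orth_proj_unique[OF M(1)])
  show "c *\<^sub>C orth_proj M x \<in> M"
    using M(1) orth_proj_mem[OF M] by (auto simp: csubspace_def)
  have "cinner (c *\<^sub>C x - c *\<^sub>C orth_proj M x) z = c * cinner (x - orth_proj M x) z" for z
    by (simp add: cinner_diff_left cinner_scaleC_left right_diff_distrib)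
  then show "\<forall>z\<in>M. cinner (c *\<^sub>C x - c *\<^sub>C orth_proj M x) z = 0"
    using orth_proj_orthogonal[OF M] by simp
qed

lemma bounded_linear_orth_proj:
  fixes M :: "'a::chilbert_space set"
  assumes M: "csubspace M" "closed M"
  shows "bounded_linear (orth_proj M)"
proof (rule bounded_linear_intro[where K = 1])
  let ?P = "orth_proj M"
  note mem = orth_proj_mem[OF M] and orth = orth_proj_orthogonal[OF M]
  note sub = csubspace_imp_subspace[OF M(1)]
  show "?P (x + y) = ?P x + ?P y" for x y
  proof (rule orth_proj_unique[OF M(1)])
    show "?P x + ?P y \<in> M"
      using mem sub by (simp add: subspace_add)
    show "\<forall>z\<in>M. cinner (x + y - (?P x + ?P y)) z = 0"
      using orth by (simp add: add_diff_add cinner_add_left)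
  qed
  show "?P (r *\<^sub>R x) = r *\<^sub>R ?P x" for r x
    using orth_proj_scaleC[OF M, of "of_real r" x] by (simp add: scaleC_of_real)
  show "norm (?P x) \<le> norm x * 1" for x
  proof -
    have "norm (?P x) * norm (?P x) = inner x (?P x)"
      using orth_proj_inner[OF M mem, of x x] by (simp add: flip: power2_norm_eq_inner power2_eq_square)
    also have "\<dots> \<le> norm x * norm (?P x)"
      by (rule norm_cauchy_schwarz)
    finally show ?thesis
      by (cases "?P x = 0") auto
  qed
qed

lemma subspace_closure:
  fixes M :: "'a::real_normed_vector set"
  assumes "subspace M"
  shows "subspace (closure M)"
proof (rule subspaceI)
  show "0 \<in> closure M"
    using subspace_0[OF assms] closure_subset[of M] by auto
  show "x + y \<in> closure M" if xy: "x \<in> closure M" "y \<in> closure M" for x y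
  proof -
    obtain f g where "\<forall>n. f n \<in> M" "f \<longlonglongrightarrow> x" "\<forall>n. g n \<in> M" "g \<longlonglongrightarrow> y"
      using xy unfolding closure_sequential by blast
    then have "\<forall>n. f n + g n \<in> M" "(\<lambda>n. f n + g n) \<longlonglongrightarrow> x + y"
      using assms by (auto intro: subspace_add tendsto_add)
    then show ?thesis
      unfolding closure_sequential by (intro exI[of _ "\<lambda>n. f n + g n"]) simp
  qed
  show "c *\<^sub>R x \<in> closure M" if x: "x \<in> closure M" for c x
  proof -
    obtain f where "\<forall>n. f n \<in> M" "f \<longlonglongrightarrow> x"
      using x unfolding closure_sequential by blast
    then have "\<forall>n. c *\<^sub>R f n \<in> M" "(\<lambda>n. c *\<^sub>R f n) \<longlonglongrightarrow> c *\<^sub>R x"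
      using assms by (auto intro: subspace_scale tendsto_scaleR)
    then show ?thesis
      unfolding closure_sequential by (intro exI[of _ "\<lambda>n. c *\<^sub>R f n"]) simp
  qed
qed

lemma dense_csubspace:
  fixes M :: "'a::chilbert_space set"
  assumes M: "csubspace M" and orth: "\<And>z. (\<And>x. x \<in> M \<Longrightarrow> cinner x z = 0) \<Longrightarrow> z = 0"
  shows "closure M = UNIV"
proof -
  have sub: "subspace (closure M)"
    using M by (simp add: subspace_closure csubspace_imp_subspace)
  have "x \<in> closure M" for x
  proof -
    obtain y where y: "y \<in> closure M" "\<And>z. z \<in> closure M \<Longrightarrow> inner (x - y) z = 0"
      using projection_exists[OF sub closed_closure] by blast
    have "cinner z (x - y) = 0" if "z \<in> M" for z
    proof (rule cinner_eq_0_if_inner_eq_0)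
      fix c
      have "c *\<^sub>C z \<in> closure M"
        using that M closure_subset[of M] by (auto simp: csubspace_def)
      then show "inner (c *\<^sub>C z) (x - y) = 0"
        using y(2) by (simp add: inner_commute)
    qed
    then have "x - y = 0"
      by (rule orth)
    with y(1) show ?thesis
      by simp
  qed
  then show ?thesis
    by auto
qed


section \<open>Closed densely defined operators\<close>

lemma op_of_graph_eq_Some_iff:
  assumes uniq: "\<And>y y'. (x, y) \<in> R \<Longrightarrow> (x, y') \<in> R \<Longrightarrow> y = y'"
  shows "op_of_graph R x = Some y \<longleftrightarrow> (x, y) \<in> R"
proof
  assume "op_of_graph R x = Some y"
  then have "\<exists>!y. (x, y) \<in> R" "(THE y. (x, y) \<in> R) = y"
    by (simp_all add: op_of_graph_def split: if_splits)
  then show "(x, y) \<in> R"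
    using theI'[of "\<lambda>y. (x, y) \<in> R"] by simp
next
  assume y: "(x, y) \<in> R"
  have ex1: "\<exists>!y. (x, y) \<in> R"
    using y uniq by (intro ex1I[of _ y]) blast+
  then have "(THE y. (x, y) \<in> R) = y"
    using y by (rule the1_equality)
  with ex1 show "op_of_graph R x = Some y"
    by (simp add: op_of_graph_def)
qed

lemma linear_op_zero: "linear_op S \<Longrightarrow> S 0 = Some 0"
  by (simp add: linear_op_def)

lemma linear_op_add: "linear_op S \<Longrightarrow> S x = Some u \<Longrightarrow> S y = Some v \<Longrightarrow> S (x + y) = Some (u + v)"
  by (simp add: linear_op_def)

lemma linear_op_scaleC: "linear_op S \<Longrightarrow> S x = Some u \<Longrightarrow> S (c *\<^sub>C x) = Some (c *\<^sub>C u)"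
  by (simp add: linear_op_def)

lemma linear_op_scaleR: "linear_op S \<Longrightarrow> S x = Some u \<Longrightarrow> S (r *\<^sub>R x) = Some (r *\<^sub>R u)"
  by (metis linear_op_scaleC scaleC_of_real)

lemma linear_op_diff: "linear_op S \<Longrightarrow> S x = Some u \<Longrightarrow> S y = Some v \<Longrightarrow> S (x - y) = Some (u - v)"
  using linear_op_add[of S x u "- y" "- v"] linear_op_scaleC[of S y v "-1"]
  by (simp add: scaleC_minus_one)

lemma subspace_graph: "linear_op S \<Longrightarrow> subspace (Map.graph S)"
  by (auto simp: subspace_def Map.graph_def zero_prod_def linear_op_zero linear_op_add linear_op_scaleR)

text \<open>This is what makes the adjoint of a densely defined operator single valued.\<close>

lemma inner_eq_on_dense_imp_eq:
  fixes z z' :: "'a::real_inner"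
  assumes "closure D = UNIV" "\<And>x. x \<in> D \<Longrightarrow> inner x z = inner x z'"
  shows "z = z'"
proof -
  have "closed {x. inner x z = inner x z'}"
    by (intro closed_Collect_eq continuous_intros)
  then have "closure D \<subseteq> {x. inner x z = inner x z'}"
    using assms(2) by (intro closure_minimal) auto
  then have "inner (z - z') z = inner (z - z') z'"
    using assms(1) by auto
  then have "inner (z - z') (z - z') = 0"
    by (simp add: inner_diff_right)
  then show ?thesis
    by simp
qed

lemma adjoint_op_eq_Some_iff:
  assumes "densely_defined S"
  shows "adjoint_op S y = Some z \<longleftrightarrow> (\<forall>x u. S x = Some u \<longrightarrow> cinner u y = cinner x z)"
proof -
  have "z = z'"
    if "\<forall>x u. S x = Some u \<longrightarrow> cinner u y = cinner x z" "\<forall>x u. S x = Some u \<longrightarrow> cinner u y = cinner x z'" for z z'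
    using assms that
    by (intro inner_eq_on_dense_imp_eq[of "dom S"])
      (auto simp: densely_defined_def inner_eq_Re_cinner)
  then show ?thesis
    unfolding adjoint_op_def by (subst op_of_graph_eq_Some_iff) auto
qed

text \<open>The vector \<open>u = reg_adjoint B F\<close> is the one for which \<open>(u, B u)\<close> is the orthogonal projection of
  \<open>(0, F)\<close> onto the graph of \<open>B\<close>; equivalently, it minimizes \<open>\<parallel>u\<parallel>\<^sup>2 + \<parallel>B u - F\<parallel>\<^sup>2\<close>. This variational
  description is meaningful for every \<open>F\<close>, in contrast to the formula \<open>(1 + B\<^sup>* B)\<^sup>-\<^sup>1 B\<^sup>* F\<close>, which
  requires \<open>F\<close> to be in the domain of \<open>B\<^sup>*\<close>.\<close>

definition reg_adjoint :: "'a::chilbert_space pop \<Rightarrow> 'a \<Rightarrow> 'a" where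
  "reg_adjoint B F = (THE u. \<exists>v. B u = Some v \<and> adjoint_op B (F - v) = Some u)"

locale closed_dense_op =
  fixes B :: "'a::chilbert_space pop"
  assumes linear: "linear_op B" and closed: "closed_op B" and dense: "densely_defined B"
begin

lemma adjoint_iff: "adjoint_op B y = Some z \<longleftrightarrow> (\<forall>x u. B x = Some u \<longrightarrow> cinner u y = cinner x z)"
  by (rule adjoint_op_eq_Some_iff[OF dense])

lemma adjoint_inner: "adjoint_op B y = Some z \<Longrightarrow> B x = Some u \<Longrightarrow> inner u y = inner x z"
  by (simp add: adjoint_iff inner_eq_Re_cinner)

lemma linear_adjoint: "linear_op (adjoint_op B)"
  unfolding linear_op_def adjoint_iff by (simp add: cinner_add_right cinner_scaleC_right)

text \<open>The orthogonal complement of the graph of \<open>B\<close> consists of the pairs \<open>(- B\<^sup>* g, g)\<close>. Projecting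
  \<open>(0, F)\<close> onto the closed graph therefore writes it as \<open>(u, v) + (- B\<^sup>* g, g)\<close> with \<open>v = B u\<close>, that is,
  \<open>g = F - v\<close> and \<open>u = B\<^sup>* g\<close>.\<close>

lemma graph_decomposition:
  "\<exists>u v. B u = Some v \<and> adjoint_op B (F - v) = Some u"
proof -
  have "\<exists>p\<in>Map.graph B. \<forall>q\<in>Map.graph B. inner ((0, F) - p) q = 0"
    using linear closed by (intro projection_exists subspace_graph) (auto simp: closed_op_def)
  then obtain u v where uv: "(u, v) \<in> Map.graph B"
      "\<And>x w. (x, w) \<in> Map.graph B \<Longrightarrow> inner ((0, F) - (u, v)) (x, w) = 0"
    by (metis surj_pair)
  have orth: "inner w (F - v) = inner x u" if "B x = Some w" for x w
    using uv(2)[of x w] that by (simp add: in_graphI inner_commute)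
  have "cinner w (F - v) = cinner x u" if "B x = Some w" for x w
    using orth[OF that] orth[OF linear_op_scaleC[OF linear that, of \<i>]]
    by (simp add: inner_eq_Re_cinner cinner_scaleC_left complex_eq_iff)
  with in_graphD[OF uv(1)] show ?thesis
    by (auto simp: adjoint_iff)
qed

lemma decomposition_energy:
  assumes "B u = Some v" "adjoint_op B (F - v) = Some u"
  shows "(norm u)\<^sup>2 + (norm v)\<^sup>2 = inner v F"
  using adjoint_inner[OF assms(2,1)] by (simp add: power2_norm_eq_inner inner_diff_right)

lemma decomposition_unique:
  assumes "B u = Some v" "adjoint_op B (F - v) = Some u"
    and "B u' = Some v'" "adjoint_op B (F - v') = Some u'"
  shows "u = u'"
proof -
  have "B (u - u') = Some (v - v')"
    using assms linear by (simp add: linear_op_diff)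
  moreover have "adjoint_op B (0 - (v - v')) = Some (u - u')"
    using linear_op_diff[OF linear_adjoint assms(2,4)] by simp
  ultimately have "(norm (u - u'))\<^sup>2 + (norm (v - v'))\<^sup>2 = inner (v - v') 0"
    by (rule decomposition_energy)
  then show ?thesis
    by (simp add: add_nonneg_eq_0_iff)
qed

lemma reg_adjoint_eqI:
  assumes "B u = Some v" "adjoint_op B (F - v) = Some u"
  shows "reg_adjoint B F = u"
  unfolding reg_adjoint_def using assms decomposition_unique by blast

lemma reg_adjoint_decomposition:
  "\<exists>v. B (reg_adjoint B F) = Some v \<and> adjoint_op B (F - v) = Some (reg_adjoint B F)"
  using graph_decomposition[of F] reg_adjoint_eqI by metis

lemma bounded_linear_reg_adjoint: "bounded_linear (reg_adjoint B)"
proof (rule bounded_linear_intro[where K = 1])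
  show "reg_adjoint B (F + G) = reg_adjoint B F + reg_adjoint B G" for F G
  proof -
    obtain v w where v: "B (reg_adjoint B F) = Some v" "adjoint_op B (F - v) = Some (reg_adjoint B F)"
      and w: "B (reg_adjoint B G) = Some w" "adjoint_op B (G - w) = Some (reg_adjoint B G)"
      using reg_adjoint_decomposition by metis
    show ?thesis
      using linear_op_add[OF linear v(1) w(1)] linear_op_add[OF linear_adjoint v(2) w(2)]
      by (intro reg_adjoint_eqI) (auto simp: algebra_simps)
  qed
  show "reg_adjoint B (r *\<^sub>R F) = r *\<^sub>R reg_adjoint B F" for r F
  proof -
    obtain v where v: "B (reg_adjoint B F) = Some v" "adjoint_op B (F - v) = Some (reg_adjoint B F)"
      using reg_adjoint_decomposition by metis
    show ?thesis
      using linear_op_scaleR[OF linear v(1), of r] linear_op_scaleR[OF linear_adjoint v(2), of r]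
      by (intro reg_adjoint_eqI) (auto simp: algebra_simps)
  qed
  show "norm (reg_adjoint B F) \<le> norm F * 1" for F
  proof -
    obtain v where v: "B (reg_adjoint B F) = Some v" "adjoint_op B (F - v) = Some (reg_adjoint B F)"
      using reg_adjoint_decomposition by metis
    let ?u = "reg_adjoint B F"
    have "(norm ?u)\<^sup>2 + (norm v)\<^sup>2 \<le> norm v * norm F"
      using decomposition_energy[OF v] norm_cauchy_schwarz[of v F] by simp
    also have "\<dots> \<le> (norm v)\<^sup>2 + (norm F)\<^sup>2"
      using sum_squares_bound[of "norm v" "norm F"] mult_nonneg_nonneg[OF norm_ge_zero[of v] norm_ge_zero[of F]]
      by linarith
    finally show ?thesis
      using power2_le_imp_le by auto
  qed
qed

text \<open>If \<open>z\<close> is orthogonal to the domain of \<open>B\<^sup>*\<close>, then \<open>(0, z)\<close> is orthogonal to all pairs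
  \<open>(- B\<^sup>* g, g)\<close>, hence lies in the closed graph of \<open>B\<close>, and \<open>z = B 0 = 0\<close>.\<close>

lemma dense_dom_adjoint: "closure (dom (adjoint_op B)) = UNIV"
proof (rule dense_csubspace)
  show "csubspace (dom (adjoint_op B))"
    unfolding csubspace_def
    by (auto intro: linear_op_zero[OF linear_adjoint] linear_op_add[OF linear_adjoint]
      linear_op_scaleC[OF linear_adjoint])
  fix z assume z: "\<And>x. x \<in> dom (adjoint_op B) \<Longrightarrow> cinner x z = 0"
  obtain u v where uv: "B u = Some v" "adjoint_op B (z - v) = Some u"
    using graph_decomposition by blast
  have "inner (z - v) z = 0"
    using z[of "z - v"] uv(2) by (simp add: domIff inner_eq_Re_cinner)
  moreover have "inner (z - v) v = (norm u)\<^sup>2"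
    using adjoint_inner[OF uv(2,1)] by (simp add: inner_commute power2_norm_eq_inner)
  ultimately have "(norm (z - v))\<^sup>2 + (norm u)\<^sup>2 = 0"
    by (simp add: power2_norm_eq_inner inner_diff_right)
  then have "z = v" "u = 0"
    by (simp_all add: add_nonneg_eq_0_iff)
  then show "z = 0"
    using uv(1) linear_op_zero[OF linear] by simp
qed

text \<open>The inverse is a function because \<open>1 + B\<^sup>* B\<close> is injective: pairing \<open>x + B\<^sup>* B x = 0\<close> with \<open>x\<close>
  gives \<open>\<parallel>x\<parallel>\<^sup>2 + \<parallel>B x\<parallel>\<^sup>2 = 0\<close>.\<close>

lemma inverse_one_plus_normal_eq_Some_iff:
  "inverse_op (plus_op Some (adjoint_op B \<circ>\<^sub>m B)) y = Some u \<longleftrightarrow>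
    (\<exists>v z. B u = Some v \<and> adjoint_op B v = Some z \<and> u + z = y)"
proof -
  have normal: "(u, y) \<in> Map.graph (plus_op Some (adjoint_op B \<circ>\<^sub>m B)) \<longleftrightarrow>
      (\<exists>v z. B u = Some v \<and> adjoint_op B v = Some z \<and> u + z = y)" for u y
    by (auto simp: Map.graph_def plus_op_def map_comp_def split: option.splits)
  have uniq: "u = u'"
    if u: "B u = Some v" "adjoint_op B v = Some z" "u + z = y"
      and u': "B u' = Some v'" "adjoint_op B v' = Some z'" "u' + z' = y" for u v z u' v' z'
  proof -
    have "B (u - u') = Some (v - v')"
      using linear_op_diff[OF linear u(1) u'(1)] .
    moreover have "adjoint_op B (v - v') = Some (u' - u)"
      using linear_op_diff[OF linear_adjoint u(2) u'(2)] u(3) u'(3)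
      by (metis add_diff_cancel_left' add_diff_cancel_right' add_diff_eq diff_add_eq_diff_diff_swap)
    ultimately have "inner (v - v') (v - v') = inner (u - u') (u' - u)"
      using adjoint_inner by blast
    then have "(norm (v - v'))\<^sup>2 + (norm (u - u'))\<^sup>2 = 0"
      by (simp add: power2_norm_eq_inner inner_diff_right algebra_simps)
    then show ?thesis
      by (simp add: add_nonneg_eq_0_iff)
  qed
  show ?thesis
    unfolding inverse_op_def
    by (subst op_of_graph_eq_Some_iff) (auto simp: normal intro: uniq)
qed

text \<open>On the domain of \<open>B\<^sup>*\<close> the decomposition \<open>u = B\<^sup>* (F - B u)\<close> can be expanded to
  \<open>u + B\<^sup>* B u = B\<^sup>* F\<close>, so both operators agree there. That domain is dense and the regularized adjoint
  is continuous, hence its full graph is the closure.\<close>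

lemma closure_reg_adjoint:
  "closure_op (inverse_op (plus_op Some (adjoint_op B \<circ>\<^sub>m B)) \<circ>\<^sub>m adjoint_op B) F
    = Some (reg_adjoint B F)"
proof -
  let ?R = "inverse_op (plus_op Some (adjoint_op B \<circ>\<^sub>m B)) \<circ>\<^sub>m adjoint_op B"
  let ?D = "dom (adjoint_op B)" and ?g = "\<lambda>F. (F, reg_adjoint B F)"
  have cont: "continuous_on S (reg_adjoint B)" for S
    using bounded_linear_reg_adjoint by (simp add: linear_continuous_on)
  have R: "?R F = Some u \<longleftrightarrow> F \<in> ?D \<and> u = reg_adjoint B F" for F u
  proof
    assume "?R F = Some u"
    then obtain y v z where *: "adjoint_op B F = Some y" "B u = Some v" "adjoint_op B v = Some z" "u + z = y"
      by (auto simp: map_comp_Some_iff inverse_one_plus_normal_eq_Some_iff)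
    then have "adjoint_op B (F - v) = Some u"
      using linear_op_diff[OF linear_adjoint *(1,3)] by auto
    with * show "F \<in> ?D \<and> u = reg_adjoint B F"
      using reg_adjoint_eqI by auto
  next
    assume F: "F \<in> ?D \<and> u = reg_adjoint B F"
    then obtain y v where *: "adjoint_op B F = Some y" "B u = Some v" "adjoint_op B (F - v) = Some u"
      using reg_adjoint_decomposition[of F] by blast
    then have "adjoint_op B v = Some (y - u)"
      using linear_op_diff[OF linear_adjoint *(1,3)] by simp
    with * show "?R F = Some u"
      by (auto simp: map_comp_Some_iff inverse_one_plus_normal_eq_Some_iff)
  qed
  have graph: "Map.graph ?R = ?g ` ?D"
    unfolding Map.graph_def R by blast
  have "closure (?g ` ?D) = range ?g"
  proof (rule antisym)
    have "range ?g = {p. snd p = reg_adjoint B (fst p)}"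
      by (auto simp: image_iff)
    moreover have "closed {p. snd p = reg_adjoint B (fst p)}"
      by (intro closed_Collect_eq continuous_intros continuous_on_compose2[OF cont]) auto
    ultimately show "closure (?g ` ?D) \<subseteq> range ?g"
      by (intro closure_minimal) auto
    have "?g ` closure ?D \<subseteq> closure (?g ` ?D)"
      by (intro image_closure_subset continuous_intros cont closed_closure closure_subset)
    then show "range ?g \<subseteq> closure (?g ` ?D)"
      by (simp add: dense_dom_adjoint)
  qed
  then show ?thesis
    unfolding closure_op_def graph by (subst op_of_graph_eq_Some_iff) auto
qed

end

section \<open>Dissipation of the modified entropy\<close>

text \<open>The discriminant criterion by which the sign of \<open>h_star\<close> controls the decay rate.\<close>

lemma quadratic_form_nonneg:
  fixes p q r x y :: real
  assumes "p > 0" "r\<^sup>2 \<le> 4 * p * q"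
  shows "r * x * y \<le> p * x\<^sup>2 + q * y\<^sup>2"
proof -
  have "0 \<le> (2 * p * x - r * y)\<^sup>2 + (4 * p * q - r\<^sup>2) * y\<^sup>2"
    using assms by simp
  also have "\<dots> = 4 * p * (p * x\<^sup>2 + q * y\<^sup>2 - r * x * y)"
    by (simp add: power2_eq_square algebra_simps)
  finally show ?thesis
    using assms(1) by (simp add: zero_le_mult_iff)
qed

locale hypocoercive =
  fixes L T :: "'a::chilbert_space pop" and lm lM CM :: real
  assumes L: "linear_op L" "closed_op L" "hermitian_op L"
    and T: "linear_op T" "closed_op T" "antihermitian_op T"
    and TP_dense: "densely_defined (T \<circ> null_proj L)"
    and pos: "lm > 0" "lM > 0" "CM > 0"
    and micro: "\<And>x u. L x = Some u \<Longrightarrow> - Re (cinner u x) \<ge> lm * (norm (x - null_proj L x))\<^sup>2"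
    and macro: "\<And>x u. T (null_proj L x) = Some u \<Longrightarrow> (norm u)\<^sup>2 \<ge> lM * (norm (null_proj L x))\<^sup>2"
    and diffusive: "\<And>x u. T (null_proj L x) = Some u \<Longrightarrow> null_proj L u = 0"
    and bdd: "\<And>x u v. (A_op L T \<circ>\<^sub>m T) (x - null_proj L x) = Some u \<Longrightarrow>
      (A_op L T \<circ>\<^sub>m L) x = Some v \<Longrightarrow> norm u + norm v \<le> CM * norm (x - null_proj L x)"
begin

abbreviation P :: "'a \<Rightarrow> 'a" where "P \<equiv> null_proj L"

abbreviation A :: "'a \<Rightarrow> 'a" where "A \<equiv> reg_adjoint (T \<circ> P)"

lemma csubspace_null_space: "csubspace (null_space L)"
  using linear_op_zero[OF L(1)] linear_op_add[OF L(1), of _ 0 _ 0] linear_op_scaleC[OF L(1), of _ 0]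
  by (auto simp: csubspace_def null_space_def scaleC_zero)

lemma closed_null_space: "closed (null_space L)"
proof -
  have "null_space L = (\<lambda>x. (x, 0)) -` Map.graph L"
    by (auto simp: null_space_def Map.graph_def)
  moreover have "closed ((\<lambda>x::'a. (x, 0::'a)) -` Map.graph L)"
    using L(2) by (intro closed_vimage continuous_intros) (simp add: closed_op_def)
  ultimately show ?thesis
    by simp
qed

lemma bounded_linear_P: "bounded_linear P"
  unfolding null_proj_def by (rule bounded_linear_orth_proj[OF csubspace_null_space closed_null_space])

lemma P_scaleC: "P (c *\<^sub>C x) = c *\<^sub>C P x"
  unfolding null_proj_def by (rule orth_proj_scaleC[OF csubspace_null_space closed_null_space])

lemma L_P: "L (P x) = Some 0"
  using orth_proj_mem[OF csubspace_null_space closed_null_space]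
  by (simp add: null_proj_def null_space_def)

lemma P_fixed: "L x = Some 0 \<Longrightarrow> P x = x"
  using orth_proj_fixed[OF csubspace_null_space] by (simp add: null_proj_def null_space_def)

lemma P_idem: "P (P x) = P x"
  by (rule P_fixed[OF L_P])

lemma P_add: "P (x + y) = P x + P y" and P_diff: "P (x - y) = P x - P y" and P_zero: "P 0 = 0"
  using bounded_linear_P by (simp_all add: linear_simps)

lemma inner_P: "inner (P x) (P y) = inner x (P y)"
  using orth_proj_inner[OF csubspace_null_space closed_null_space, of "P y" x] L_P[of y]
  by (simp add: null_proj_def null_space_def)

lemma pythagoras_P: "(norm x)\<^sup>2 = (norm (x - P x))\<^sup>2 + (norm (P x))\<^sup>2"
  using inner_P[of x x]
  by (simp add: power2_norm_eq_inner inner_diff_left inner_diff_right inner_commute)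

sublocale TP: closed_dense_op "T \<circ> P"
proof
  show "linear_op (T \<circ> P)"
    using T(1) unfolding linear_op_def by (auto simp: P_add P_zero P_scaleC)
  have "Map.graph (T \<circ> P) = (\<lambda>p. (P (fst p), snd p)) -` Map.graph T"
    by (auto simp: Map.graph_def)
  moreover have "closed ((\<lambda>p. (P (fst p), snd p)) -` Map.graph T)"
    using T(2)
    by (intro closed_vimage continuous_intros bounded_linear.continuous_on[OF bounded_linear_P])
      (simp add: closed_op_def)
  ultimately show "closed_op (T \<circ> P)"
    by (simp add: closed_op_def)
qed (rule TP_dense)

lemma A_op_eq: "A_op L T F = Some (A F)"
  unfolding A_op_def Let_def by (rule TP.closure_reg_adjoint)

lemma H1_eq: "H1 L T \<delta> F = 1/2 * (norm F)\<^sup>2 + \<delta> * inner (A F) F"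
  by (simp add: H1_def A_op_eq inner_eq_Re_cinner)

text \<open>\<open>A F\<close> is in the range of \<open>(T P)\<^sup>*\<close>, which is orthogonal to the null space of \<open>T P\<close>; this null
  space contains all microscopic vectors \<open>x - P x\<close>.\<close>

lemma P_A: "P (A F) = A F"
proof -
  obtain v where v: "adjoint_op (T \<circ> P) (F - v) = Some (A F)"
    using TP.reg_adjoint_decomposition by blast
  have "(T \<circ> P) (A F - P (A F)) = Some 0"
    by (simp add: P_diff P_idem linear_op_zero[OF T(1)])
  from TP.adjoint_inner[OF v this] have "inner (A F - P (A F)) (A F) = 0"
    by simp
  then have "inner (A F - P (A F)) (A F - P (A F)) = 0"
    using inner_P[of "A F" "A F"] by (simp add: inner_diff_left inner_diff_right)
  then show ?thesis
    by simp
qed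

text \<open>Pairing the decomposition \<open>F = v + g\<close>, where \<open>v = T A F\<close> and \<open>(T P)\<^sup>* g = A F\<close>, with \<open>v\<close> gives
  \<open>\<parallel>A F\<parallel>\<^sup>2 + \<parallel>v\<parallel>\<^sup>2 = \<langle>v, F\<rangle>\<close>. As \<open>v\<close> is microscopic, only the microscopic part of \<open>F\<close> counts on
  the right, and Young's inequality gives both bounds. The factor \<open>1/2\<close> in the first is what makes
  the constant \<open>(2 + \<delta>) / (2 - \<delta>)\<close> come out.\<close>

lemma A_bounds:
  obtains v where "T (A F) = Some v" "adjoint_op (T \<circ> P) (F - v) = Some (A F)"
    "norm (A F) \<le> norm (F - P F) / 2" "inner v F \<le> (norm (F - P F))\<^sup>2"
proof -
  obtain v where v: "(T \<circ> P) (A F) = Some v" "adjoint_op (T \<circ> P) (F - v) = Some (A F)"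
    using TP.reg_adjoint_decomposition by blast
  let ?x = "norm (F - P F)"
  have "P v = 0"
    using diffusive v(1) by simp
  then have "inner v F = inner v (F - P F)"
    using inner_P[of v F] by (simp add: inner_diff_right)
  then have vF: "inner v F \<le> norm v * ?x"
    using norm_cauchy_schwarz[of v "F - P F"] by simp
  then have le: "(norm (A F))\<^sup>2 + (norm v)\<^sup>2 \<le> norm v * ?x"
    using TP.decomposition_energy[OF v] by simp
  then have "norm v * norm v \<le> norm v * ?x"
    using zero_le_power2[of "norm (A F)"] unfolding power2_eq_square by linarith
  then have "norm v \<le> ?x"
    by (cases "v = 0") auto
  then have "norm v * ?x \<le> ?x\<^sup>2"
    unfolding power2_eq_square by (rule mult_right_mono) simp
  then have "inner v F \<le> ?x\<^sup>2"
    using vF by linarith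
  moreover have "(2 * norm (A F))\<^sup>2 \<le> ?x\<^sup>2"
    using le zero_le_power2[of "2 * norm v - ?x"] by (simp add: power2_eq_square algebra_simps)
  then have "2 * norm (A F) \<le> ?x"
    using power2_le_imp_le norm_ge_zero by blast
  ultimately show thesis
    using that v by (simp add: P_A)
qed

lemma inner_A: "inner (A F) G = inner (A F) (P G)"
  using inner_P[of G "A F"] by (simp add: P_A inner_commute)

lemma abs_inner_A_le: "\<bar>inner (A F) F\<bar> \<le> norm (F - P F) * norm (P F) / 2"
proof -
  have "norm (A F) \<le> norm (F - P F) / 2"
    using A_bounds[of F] by blast
  then have "norm (A F) * norm (P F) \<le> norm (F - P F) / 2 * norm (P F)"
    by (rule mult_right_mono) simp
  with Cauchy_Schwarz_ineq2[of "A F" "P F"] show ?thesis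
    by (simp add: inner_A[of F F])
qed

text \<open>On macroscopic vectors \<open>A T P\<close> is \<open>S / (1 + S)\<close> with \<open>S = (T P)\<^sup>* T P\<close>, and the assumption on
  \<open>T P\<close> says \<open>S \<ge> lM\<close>, so the bound is the monotonicity of \<open>s / (1 + s)\<close>. Instead of spectral
  calculus, the resolvent \<open>y = (1 + S)\<^sup>-\<^sup>1 P F\<close> is used: with \<open>P F = y + S y\<close>, everything is expressed
  by \<open>a = \<parallel>y\<parallel>\<close>, \<open>b = \<parallel>T y\<parallel>\<close>, \<open>c = \<parallel>S y\<parallel>\<close>, and the claim reduces to \<open>lM * a\<^sup>2 \<le> b\<^sup>2\<close>, which is
  assumed, and \<open>lM * b\<^sup>2 \<le> c\<^sup>2\<close>, which follows from it and the interpolation \<open>b\<^sup>2 \<le> a * c\<close>.\<close>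

lemma macroscopic_coercivity:
  assumes w: "T (P F) = Some w"
  shows "K_M lM * (norm (P F))\<^sup>2 \<le> inner (A w) F"
proof -
  define u where "u = A w"
  (* y is the resolvent (1 + S)^(-1) applied to P F, and u is S y *)
  define y where "y = P F - u"
  obtain v where v: "T u = Some v" "adjoint_op (T \<circ> P) (w - v) = Some u"
    using A_bounds unfolding u_def by blast
  have Py: "P y = y"
    by (simp add: y_def u_def P_diff P_idem P_A)
  have Ty: "T y = Some (w - v)"
    unfolding y_def by (rule linear_op_diff[OF T(1) w v(1)])
  define a b c where "a = norm y" and "b = norm (w - v)" and "c = norm u"
  have nonneg: "a \<ge> 0" "b \<ge> 0" "c \<ge> 0"
    by (simp_all add: a_def b_def c_def)
  have yu: "inner y u = b\<^sup>2"
    using TP.adjoint_inner[OF v(2), of y] Ty Py by (simp add: b_def power2_norm_eq_inner)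
  have ab: "lM * a\<^sup>2 \<le> b\<^sup>2"
    using macro[of y "w - v"] Ty Py by (simp add: a_def b_def)
  have bac: "b\<^sup>2 \<le> a * c"
    using yu norm_cauchy_schwarz[of y u] by (simp add: a_def c_def)
  have bc: "lM * b\<^sup>2 \<le> c\<^sup>2"
  proof (cases "a = 0")
    case True
    then show ?thesis
      using bac by simp
  next
    case False
    have "lM * a * a \<le> c * a"
      using ab bac by (simp add: power2_eq_square ac_simps)
    then have "lM * a \<le> c"
      using False nonneg by simp
    then have "lM * a * c \<le> c * c"
      using nonneg by (intro mult_right_mono)
    moreover have "lM * b\<^sup>2 \<le> lM * (a * c)"
      using bac pos by simp
    ultimately show ?thesis
      by (simp add: power2_eq_square mult.assoc)
  qed
  have uF: "inner (A w) F = b\<^sup>2 + c\<^sup>2"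
  proof -
    have "inner (A w) F = inner u (y + u)"
      using inner_A[of w F] by (simp add: y_def u_def)
    then show ?thesis
      using yu by (simp add: inner_add_right inner_commute c_def power2_norm_eq_inner)
  qed
  have PF: "(norm (P F))\<^sup>2 = a\<^sup>2 + 2 * b\<^sup>2 + c\<^sup>2"
  proof -
    have "P F = y + u"
      by (simp add: y_def)
    then show ?thesis
      using yu by (simp add: power2_norm_eq_inner inner_add_left inner_add_right inner_commute a_def c_def)
  qed
  have "lM * (a\<^sup>2 + 2 * b\<^sup>2 + c\<^sup>2) \<le> (1 + lM) * (b\<^sup>2 + c\<^sup>2)"
    using ab bc by (simp add: algebra_simps)
  then show ?thesis
    using pos(2) unfolding uF PF K_M_def by (simp add: field_simps)
qed

text \<open>The left-hand side is the derivative of the entropy along \<open>F' = L F - T F\<close>. The operator \<open>T\<close>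
  does not contribute to the derivative of \<open>\<parallel>F\<parallel>\<^sup>2 / 2\<close>, so that alone only the microscopic part is
  damped. The correction recovers the macroscopic part by \<open>- \<langle>A T P F, F\<rangle>\<close>. Every other term
  carries a factor \<open>\<parallel>F - P F\<parallel>\<close>: \<open>A L F\<close> and \<open>A T (F - P F)\<close> are bounded by assumption and, \<open>A\<close> having macroscopic
  values, only meet \<open>P F\<close>; \<open>\<langle>A F, L F\<rangle>\<close> vanishes as \<open>L A F = 0\<close>; and \<open>- \<langle>A F, T F\<rangle> = \<langle>T A F, F\<rangle>\<close> is at
  most \<open>\<parallel>F - P F\<parallel>\<^sup>2\<close>.\<close>

lemma entropy_dissipation:
  assumes F: "L F = Some u" "T F = Some v" "P F \<in> dom T" and \<delta>: "\<delta> > 0"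
  defines "X \<equiv> norm (F - P F)" and "Y \<equiv> norm (P F)"
  shows "inner (u - v) F + \<delta> * (inner (A (u - v)) F + inner (A F) (u - v))
    \<le> - (lm - \<delta>) * X\<^sup>2 + \<delta> * CM * X * Y - \<delta> * K_M lM * Y\<^sup>2"
proof -
  obtain w where w: "T (P F) = Some w"
    using F(3) by blast
  have Lu: "inner u F \<le> - lm * X\<^sup>2"
    using micro[OF F(1)] by (simp add: X_def inner_eq_Re_cinner)
  have Tv: "inner v F = 0"
    using T(3) F(2) unfolding antihermitian_op_def
    by (metis inner_commute inner_eq_Re_cinner neg_equal_zero uminus_complex.simps(1))
  have "T (F - P F) = Some (v - w)"
    by (rule linear_op_diff[OF T(1) F(2) w])
  then have "norm (A (v - w)) + norm (A u) \<le> CM * X"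
    using bdd[of F "A (v - w)" "A u"] F(1) by (simp add: X_def A_op_eq)
  then have "norm (A u - A (v - w)) \<le> CM * X"
    using norm_triangle_ineq4[of "A u" "A (v - w)"] by simp
  then have "norm (A u - A (v - w)) * Y \<le> CM * X * Y"
    by (rule mult_right_mono) (simp add: Y_def)
  moreover have "inner (A u - A (v - w)) F = inner (A u - A (v - w)) (P F)"
    using inner_A[of u F] inner_A[of "v - w" F] by (simp add: inner_diff_left)
  ultimately have err: "inner (A u - A (v - w)) F \<le> CM * X * Y"
    using norm_cauchy_schwarz[of "A u - A (v - w)" "P F"] by (simp add: Y_def)
  have A_split: "A (u - v) = (A u - A (v - w)) - A w"
    by (simp add: linear_diff[OF bounded_linear.linear[OF TP.bounded_linear_reg_adjoint]])
  have Aw: "K_M lM * Y\<^sup>2 \<le> inner (A w) F"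
    unfolding Y_def by (rule macroscopic_coercivity[OF w])
  have "L (A F) = Some 0"
    using L_P[of "A F"] by (simp add: P_A)
  then have "cinner 0 F = cinner (A F) u"
    using L(3) F(1) unfolding hermitian_op_def by blast
  then have ALu: "inner (A F) u = 0"
    by (simp add: inner_eq_Re_cinner)
  obtain z where z: "T (A F) = Some z" "inner z F \<le> X\<^sup>2"
    using A_bounds unfolding X_def by blast
  have "cinner z F = - cinner (A F) v"
    using T(3) z(1) F(2) unfolding antihermitian_op_def by blast
  then have "- inner (A F) v \<le> X\<^sup>2"
    using z(2) by (simp add: inner_eq_Re_cinner)
  then have "inner (A (u - v)) F + inner (A F) (u - v) \<le> CM * X * Y - K_M lM * Y\<^sup>2 + X\<^sup>2"
    using err Aw ALu unfolding A_split by (simp add: inner_diff_left inner_diff_right)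
  then have "\<delta> * (inner (A (u - v)) F + inner (A F) (u - v)) \<le> \<delta> * (CM * X * Y - K_M lM * Y\<^sup>2 + X\<^sup>2)"
    using \<delta> by simp
  then show ?thesis
    using Lu Tv by (simp add: inner_diff_left algebra_simps)
qed

text \<open>After adding \<open>lam * H1\<close> to the dissipation estimate, what remains is a quadratic form in
  \<open>(X, Y)\<close> whose discriminant is \<open>h_star\<close>; membership in the region makes its leading coefficient
  positive.\<close>

lemma entropy_decay_rate:
  assumes F: "L F = Some u" "T F = Some v" "P F \<in> dom T"
    and region: "(\<delta>, lam) \<in> T_region lm" "h_star lm lM CM \<delta> lam \<le> 0"
  shows "inner (u - v) F + \<delta> * (inner (A (u - v)) F + inner (A F) (u - v)) \<le> - lam * H1 L T \<delta> F"
proof -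
  define X Y where "X = norm (F - P F)" and "Y = norm (P F)"
  have \<delta>: "\<delta> > 0" and lam: "lam > 0" and p: "lm - \<delta> - lam/2 > 0"
    using region(1) by (auto simp: T_region_def)
  have "(\<delta> * (CM + lam/2)) * X * Y \<le> (lm - \<delta> - lam/2) * X\<^sup>2 + (\<delta> * K_M lM - lam/2) * Y\<^sup>2"
    using p region(2)
    by (intro quadratic_form_nonneg) (auto simp: h_star_def K_M_def power_mult_distrib)
  moreover have "inner (u - v) F + \<delta> * (inner (A (u - v)) F + inner (A F) (u - v))
      \<le> - (lm - \<delta>) * X\<^sup>2 + \<delta> * CM * X * Y - \<delta> * K_M lM * Y\<^sup>2"
    using entropy_dissipation[OF F \<delta>] by (simp add: X_def Y_def)
  moreover have "lam * H1 L T \<delta> F \<le> lam * (1/2 * (X\<^sup>2 + Y\<^sup>2) + \<delta> * (X * Y / 2))"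
  proof -
    have "inner (A F) F \<le> X * Y / 2"
      using abs_inner_A_le[of F] unfolding X_def Y_def by linarith
    then have "\<delta> * inner (A F) F \<le> \<delta> * (X * Y / 2)"
      using \<delta> by (intro mult_left_mono) simp_all
    then have "H1 L T \<delta> F \<le> 1/2 * (X\<^sup>2 + Y\<^sup>2) + \<delta> * (X * Y / 2)"
      unfolding H1_eq X_def Y_def pythagoras_P[of F, symmetric] by simp
    then show ?thesis
      using lam by (intro mult_left_mono) simp_all
  qed
  ultimately show ?thesis
    by (simp add: algebra_simps)
qed

lemma classical_solution_decay:
  assumes F: "classical_solution L T F"
    and region: "(\<delta>, lam) \<in> T_region lm" "h_star lm lM CM \<delta> lam \<le> 0" and "t \<ge> 0"
  shows "H1 L T \<delta> (F t) \<le> H1 L T \<delta> (F 0) * exp (- lam * t)"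
proof -
  (* Gronwall's argument: the entropy times the growing exponential is nonincreasing *)
  define g where "g s = H1 L T \<delta> (F s) * exp (lam * s)" for s
  note blA = TP.bounded_linear_reg_adjoint
  have cont: "continuous_on {0..} F"
    using F by (simp add: classical_solution_def)
  have "g t \<le> g 0"
  proof (rule DERIV_nonpos_imp_decreasing_open[of 0 t g])
    show "continuous_on {0..t} g"
      unfolding g_def H1_eq
      by (intro continuous_intros bounded_linear.continuous_on[OF blA] continuous_on_subset[OF cont]) auto
    fix s assume s: "0 < s" "s < t"
    then obtain u v w where uvw: "P (F s) \<in> dom T" "L (F s) = Some u" "T (F s) = Some v"
      "(F has_vector_derivative w) (at s)" "w + v = u"
      using F unfolding classical_solution_def by blast
    then have w: "w = u - v"
      by (simp add: algebra_simps)
    let ?D = "inner w (F s) + \<delta> * (inner (A w) (F s) + inner (A (F s)) w)"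
    have dF: "(F has_derivative (\<lambda>h. h *\<^sub>R w)) (at s)"
      using uvw(4) by (simp add: has_vector_derivative_def)
    have dA: "((\<lambda>s. A (F s)) has_derivative (\<lambda>h. h *\<^sub>R A w)) (at s)"
      using bounded_linear.has_derivative[OF blA dF] linear_simps(5)[OF blA] by simp
    have "((\<lambda>s. 1/2 * inner (F s) (F s) + \<delta> * inner (A (F s)) (F s)) has_derivative
        (\<lambda>h. 1/2 * (inner (F s) (h *\<^sub>R w) + inner (h *\<^sub>R w) (F s))
          + \<delta> * (inner (A (F s)) (h *\<^sub>R w) + inner (h *\<^sub>R A w) (F s)))) (at s)"
      by (intro has_derivative_add has_derivative_mult_right has_derivative_inner dF dA)
    moreover have "(\<lambda>h. 1/2 * (inner (F s) (h *\<^sub>R w) + inner (h *\<^sub>R w) (F s))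
          + \<delta> * (inner (A (F s)) (h *\<^sub>R w) + inner (h *\<^sub>R A w) (F s))) = (*) ?D"
      by (rule ext) (simp add: inner_commute algebra_simps)
    ultimately have "((\<lambda>s. H1 L T \<delta> (F s)) has_field_derivative ?D) (at s)"
      by (simp add: has_field_derivative_def H1_eq power2_norm_eq_inner)
    moreover have "((\<lambda>s. exp (lam * s)) has_field_derivative exp (lam * s) * lam) (at s)"
      by (auto intro!: derivative_eq_intros)
    ultimately have "(g has_field_derivative ?D * exp (lam * s) + exp (lam * s) * lam * H1 L T \<delta> (F s)) (at s)"
      unfolding g_def by (rule DERIV_mult)
    moreover have "?D * exp (lam * s) + exp (lam * s) * lam * H1 L T \<delta> (F s) \<le> 0"
    proof -
      have "?D + lam * H1 L T \<delta> (F s) \<le> 0"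
        using entropy_decay_rate[OF uvw(2,3,1) region] by (simp add: w)
      then have "exp (lam * s) * (?D + lam * H1 L T \<delta> (F s)) \<le> 0"
        by (simp add: mult_le_0_iff)
      then show ?thesis
        by (simp add: algebra_simps)
    qed
    ultimately show "\<exists>y. (g has_real_derivative y) (at s) \<and> y \<le> 0"
      by blast
  qed fact
  then have "H1 L T \<delta> (F t) * exp (lam * t) * exp (- lam * t) \<le> H1 L T \<delta> (F 0) * exp (- lam * t)"
    unfolding g_def by (intro mult_right_mono) auto
  then show ?thesis
    by (simp add: mult.assoc flip: exp_add)
qed

text \<open>The entropy is continuous, so that the estimate passes from classical solutions to their
  limits.\<close>

lemma solution_decay:
  assumes F: "solution L T F"
    and region: "(\<delta>, lam) \<in> T_region lm" "h_star lm lM CM \<delta> lam \<le> 0" and "t \<ge> 0"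
  shows "H1 L T \<delta> (F t) \<le> H1 L T \<delta> (F 0) * exp (- lam * t)"
proof -
  obtain G where G: "\<And>n::nat. classical_solution L T (G n)" "uniform_limit {0..t} G F sequentially"
    using F unfolding solution_def by blast
  have lim: "(\<lambda>n. H1 L T \<delta> (G n s)) \<longlonglongrightarrow> H1 L T \<delta> (F s)" if "s \<in> {0..t}" for s
    unfolding H1_eq using tendsto_uniform_limitI[OF G(2) that]
    by (intro tendsto_intros bounded_linear.tendsto[OF TP.bounded_linear_reg_adjoint])
  show ?thesis
  proof (rule tendsto_le[OF sequentially_bot])
    show "(\<lambda>n. H1 L T \<delta> (G n 0) * exp (- lam * t)) \<longlonglongrightarrow> H1 L T \<delta> (F 0) * exp (- lam * t)"
      using \<open>t \<ge> 0\<close> by (intro tendsto_mult lim tendsto_const) simp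
    show "(\<lambda>n. H1 L T \<delta> (G n t)) \<longlonglongrightarrow> H1 L T \<delta> (F t)"
      using \<open>t \<ge> 0\<close> by (intro lim) simp
    show "\<forall>\<^sub>F n in sequentially. H1 L T \<delta> (G n t) \<le> H1 L T \<delta> (G n 0) * exp (- lam * t)"
      using classical_solution_decay[OF G(1) region \<open>t \<ge> 0\<close>] by simp
  qed
qed

text \<open>Since \<open>A\<close> only sees \<open>F - P F\<close> and only meets \<open>P F\<close>, the correction is at most
  \<open>\<delta> \<parallel>F - P F\<parallel> \<parallel>P F\<parallel> / 2 \<le> \<delta> \<parallel>F\<parallel>\<^sup>2 / 4\<close>.\<close>

lemma H1_norm_equivalence:
  assumes "\<delta> > 0"
  shows "(2 - \<delta>) / 4 * (norm F)\<^sup>2 \<le> H1 L T \<delta> F" "H1 L T \<delta> F \<le> (2 + \<delta>) / 4 * (norm F)\<^sup>2"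
proof -
  have "norm (F - P F) * norm (P F) / 2 \<le> (norm F)\<^sup>2 / 4"
    using sum_squares_bound[of "norm (F - P F)" "norm (P F)"] by (simp add: pythagoras_P[of F] mult.commute mult.left_commute)
  then have "\<bar>inner (A F) F\<bar> \<le> (norm F)\<^sup>2 / 4"
    using abs_inner_A_le[of F] by linarith
  then have "\<bar>\<delta> * inner (A F) F\<bar> \<le> \<delta> * ((norm F)\<^sup>2 / 4)"
    using assms by (simp add: abs_mult)
  then show "(2 - \<delta>) / 4 * (norm F)\<^sup>2 \<le> H1 L T \<delta> F" "H1 L T \<delta> F \<le> (2 + \<delta>) / 4 * (norm F)\<^sup>2"
    unfolding H1_eq by (simp_all add: abs_le_iff field_simps)
qed

end

section \<open>The optimal rate\<close>

lemma h_star_eq: "h_star lm lM CM \<delta> lam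
    = \<delta>\<^sup>2 * (CM + lam/2)\<^sup>2 - 4 * (lm - \<delta> - lam/2) * (\<delta> * K_M lM - lam/2)"
  by (simp add: h_star_def K_M_def)

context
  fixes lm lM CM :: real
  assumes pos: "lm > 0" "lM > 0" "CM > 0"
begin

abbreviation admissible :: "real \<Rightarrow> real set" where
  "admissible \<delta> \<equiv> {lam. lam > 0 \<and> (\<delta>, lam) \<in> T_region lm \<and> h_star lm lM CM \<delta> lam \<le> 0}"

lemma K_M_pos: "K_M lM > 0"
  using pos by (simp add: K_M_def)

lemma bdd_above_admissible: "bdd_above (admissible \<delta>)"
  by (rule bdd_aboveI[of _ "2 * lm"]) (auto simp: T_region_def)

lemma delta_star_pos: "delta_star lm lM CM > 0"
  using pos K_M_pos by (auto simp: delta_star_def intro!: divide_pos_pos mult_pos_pos add_pos_pos)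

lemma delta_star_less: "delta_star lm lM CM < lm"
proof -
  have "4 * K_M lM + (CM)\<^sup>2 > 0" "lm * CM\<^sup>2 > 0"
    using pos K_M_pos by (simp_all add: add_pos_pos)
  then show ?thesis
    by (simp add: delta_star_def divide_less_eq algebra_simps)
qed

text \<open>The factorization shows the meaning of \<open>delta_star\<close>: it is the value below which the
  discriminant is negative for \<open>lam = 0\<close>, and hence still for small positive rates.\<close>

lemma h_star_0: "h_star lm lM CM \<delta> 0 = \<delta> * (4 * K_M lM + CM\<^sup>2) * (\<delta> - delta_star lm lM CM)"
proof -
  have "4 * K_M lM + CM\<^sup>2 > 0"
    using pos K_M_pos by (simp add: add_pos_pos)
  then show ?thesis
    by (simp add: h_star_eq delta_star_def field_simps power2_eq_square)
qed

text \<open>As long as both factors \<open>lm - \<delta> - l/2\<close> and \<open>\<delta> * K_M lM - l/2\<close> are nonnegative their product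
  decreases in \<open>l\<close>. At \<open>\<delta> = delta_star\<close> this excludes positive rates.\<close>

lemma h_star_strict_mono:
  assumes "\<delta> > 0" "0 \<le> l" "l < l'" "l'/2 \<le> lm - \<delta>" "l'/2 \<le> \<delta> * K_M lM"
  shows "h_star lm lM CM \<delta> l < h_star lm lM CM \<delta> l'"
proof -
  have "(CM + l/2)\<^sup>2 < (CM + l'/2)\<^sup>2"
    using assms pos by (intro power_strict_mono) auto
  then have "\<delta>\<^sup>2 * (CM + l/2)\<^sup>2 < \<delta>\<^sup>2 * (CM + l'/2)\<^sup>2"
    using assms(1) by simp
  moreover have "(lm - \<delta> - l'/2) * (\<delta> * K_M lM - l'/2) \<le> (lm - \<delta> - l/2) * (\<delta> * K_M lM - l/2)"
    using assms by (intro mult_mono) auto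
  ultimately show ?thesis
    unfolding h_star_eq mult.assoc by linarith
qed

text \<open>Beyond this bound the two factors in \<open>h_star\<close> have opposite signs, which makes \<open>h_star\<close>
  positive. The bound also shows that the rate degenerates as \<open>\<delta>\<close> tends to \<open>0\<close>.\<close>

lemma admissible_le:
  assumes "lam \<in> admissible \<delta>"
  shows "lam/2 \<le> \<delta> * K_M lM"
proof (rule ccontr)
  assume "\<not> lam/2 \<le> \<delta> * K_M lM"
  then have "4 * (lm - \<delta> - lam/2) * (\<delta> * K_M lM - lam/2) < 0"
    using assms by (intro mult_pos_neg) (auto simp: T_region_def)
  moreover have "0 \<le> \<delta>\<^sup>2 * (CM + lam/2)\<^sup>2"
    by simp
  ultimately have "h_star lm lM CM \<delta> lam > 0"
    unfolding h_star_eq by linarith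
  then show False
    using assms by simp
qed

lemma admissible_nonempty:
  assumes "0 < \<delta>" "\<delta> < delta_star lm lM CM"
  shows "admissible \<delta> \<noteq> {}"
proof -
  have "h_star lm lM CM \<delta> 0 < 0"
    using assms pos K_M_pos unfolding h_star_0 by (simp add: mult_pos_neg add_pos_pos)
  moreover have "(h_star lm lM CM \<delta> \<longlongrightarrow> h_star lm lM CM \<delta> 0) (at_right 0)"
    unfolding h_star_def by (intro tendsto_intros) auto
  ultimately have "\<forall>\<^sub>F lam in at_right 0. h_star lm lM CM \<delta> lam < 0"
    by (rule order_tendstoD(2)[rotated])
  moreover have "\<forall>\<^sub>F lam in at_right 0. lam \<in> {0<..<2 * (lm - \<delta>)}"
    using assms delta_star_less by (intro eventually_at_right_real) auto
  ultimately have "\<forall>\<^sub>F lam in at_right 0. lam \<in> admissible \<delta>"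
    by eventually_elim (use assms delta_star_less in \<open>auto simp: T_region_def\<close>)
  then show ?thesis
    using eventually_happens'[OF trivial_limit_at_right_real] by blast
qed

text \<open>The admissible pairs \<open>(\<delta>, lam)\<close> form a set that is not closed. Its relaxation \<open>C\<close> by weak
  inequalities is compact, so the rate has a maximum on \<open>C\<close>. At the maximum the rate is positive, and
  pairs in \<open>C\<close> with positive rate are admissible: \<open>\<delta> = 0\<close> forces \<open>lam = 0\<close>, and on the other two
  parts of the boundary, \<open>\<delta> = delta_star\<close> and \<open>lam/2 = lm - \<delta>\<close>, \<open>h_star\<close> is positive.\<close>

lemma lambda_star_attains_max:
  "\<exists>\<delta>. is_arg_max (lambda_star lm lM CM) (\<lambda>d. 0 < d \<and> d < delta_star lm lM CM) \<delta>"
proof -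
  let ?ds = "delta_star lm lM CM" and ?h = "\<lambda>p. h_star lm lM CM (fst p) (snd p)"
  define C where "C = ({0..?ds} \<times> {0..2 * lm})
    \<inter> {p. snd p / 2 \<le> lm - fst p} \<inter> {p. snd p / 2 \<le> fst p * K_M lM} \<inter> {p. ?h p \<le> 0}"
  have "compact C"
    unfolding C_def h_star_eq
    by (intro compact_Int_closed compact_Times compact_Icc closed_Collect_le continuous_intros) auto
  have in_C: "(\<delta>, lam) \<in> C" if "0 < \<delta>" "\<delta> < ?ds" "lam \<in> admissible \<delta>" for \<delta> lam
    using that admissible_le[OF that(3)] by (auto simp: C_def T_region_def)
  have half: "0 < ?ds / 2" "?ds / 2 < ?ds"
    using delta_star_pos by auto
  obtain l where l: "l \<in> admissible (?ds / 2)"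
    using admissible_nonempty[OF half] by blast
  have "(?ds / 2, l) \<in> C"
    using in_C[OF half l] .
  then have "C \<noteq> {}"
    by blast
  from continuous_attains_sup[OF \<open>compact C\<close> this continuous_on_snd[OF continuous_on_id]]
  obtain \<delta> lam where max: "(\<delta>, lam) \<in> C" "\<And>d l. (d, l) \<in> C \<Longrightarrow> l \<le> lam"
    by fastforce
  have "lam > 0"
    using max(2)[OF \<open>(?ds / 2, l) \<in> C\<close>] l by auto
  then have "\<delta> * K_M lM > 0"
    using max(1) by (auto simp: C_def)
  then have "\<delta> > 0"
    using K_M_pos by (simp add: zero_less_mult_iff)
  have "\<delta> \<noteq> ?ds"
  proof
    assume "\<delta> = ?ds"
    then have "h_star lm lM CM \<delta> 0 < h_star lm lM CM \<delta> lam"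
      using max(1) \<open>lam > 0\<close> \<open>\<delta> > 0\<close> by (intro h_star_strict_mono) (auto simp: C_def)
    then show False
      using max(1) \<open>\<delta> = ?ds\<close> by (simp add: C_def h_star_0)
  qed
  then have \<delta>: "0 < \<delta>" "\<delta> < ?ds"
    using max(1) \<open>\<delta> > 0\<close> by (auto simp: C_def)
  have "lam/2 \<noteq> lm - \<delta>"
  proof
    assume "lam/2 = lm - \<delta>"
    then have "h_star lm lM CM \<delta> lam = \<delta>\<^sup>2 * (CM + lam/2)\<^sup>2"
      unfolding h_star_eq by simp
    then have "h_star lm lM CM \<delta> lam > 0"
      using \<delta> pos \<open>lam > 0\<close> by (simp add: add_pos_pos)
    then show False
      using max(1) by (simp add: C_def)
  qed
  then have "lam \<in> admissible \<delta>"
    using max(1) \<open>lam > 0\<close> \<delta> delta_star_less by (auto simp: C_def T_region_def)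
  then have "lam \<le> lambda_star lm lM CM \<delta>"
    unfolding lambda_star_def by (rule cSup_upper[OF _ bdd_above_admissible])
  moreover have "lambda_star lm lM CM d \<le> lam" if "0 < d" "d < ?ds" for d
    unfolding lambda_star_def using admissible_nonempty[OF that]
    by (rule cSup_least) (use in_C[OF that] max(2) in blast)
  ultimately show ?thesis
    using \<delta> unfolding is_arg_max_def by (meson not_less order_trans)
qed

end

context hypocoercive
begin

text \<open>The supremum need not be admissible itself, but the set of rates for which the estimate holds
  is closed.\<close>

lemma solution_decay_lambda_star:
  assumes F: "solution L T F" and \<delta>: "0 < \<delta>" "\<delta> < delta_star lm lM CM" and "t \<ge> 0"
  shows "H1 L T \<delta> (F t) \<le> H1 L T \<delta> (F 0) * exp (- lambda_star lm lM CM \<delta> * t)"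
proof -
  let ?S = "admissible lm lM CM \<delta>"
  let ?R = "{lam. H1 L T \<delta> (F t) \<le> H1 L T \<delta> (F 0) * exp (- lam * t)}"
  have "closed ?R"
    by (intro closed_Collect_le continuous_intros)
  moreover have "?S \<subseteq> ?R"
    using solution_decay[OF F] \<open>t \<ge> 0\<close> by blast
  ultimately have "closure ?S \<subseteq> ?R"
    by (intro closure_minimal)
  moreover have "Sup ?S \<in> closure ?S"
    using admissible_nonempty[OF pos \<delta>] bdd_above_admissible[OF pos] by (rule closure_contains_Sup)
  ultimately show ?thesis
    unfolding lambda_star_def by blast
qed

lemma solution_norm_decay:
  assumes F: "solution L T F" and \<delta>: "0 < \<delta>" "\<delta> < delta_star lm lM CM" "\<delta> < 2" and "t \<ge> 0"
  shows "(norm (F t))\<^sup>2 \<le> C_star \<delta> * exp (- lambda_star lm lM CM \<delta> * t) * (norm (F 0))\<^sup>2"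
proof -
  let ?e = "exp (- lambda_star lm lM CM \<delta> * t)"
  have "(2 - \<delta>) / 4 * (norm (F t))\<^sup>2 \<le> H1 L T \<delta> (F t)"
    by (rule H1_norm_equivalence(1)[OF \<delta>(1)])
  also have "\<dots> \<le> H1 L T \<delta> (F 0) * ?e"
    by (rule solution_decay_lambda_star[OF F \<delta>(1,2) \<open>t \<ge> 0\<close>])
  also have "\<dots> \<le> (2 + \<delta>) / 4 * (norm (F 0))\<^sup>2 * ?e"
    by (intro mult_right_mono H1_norm_equivalence(2)[OF \<delta>(1)]) simp
  finally have "(norm (F t))\<^sup>2 * (2 - \<delta>) \<le> (2 + \<delta>) * ?e * (norm (F 0))\<^sup>2"
    by (simp add: ac_simps)
  then show ?thesis
    using \<delta>(3) by (simp add: C_star_def pos_le_divide_eq)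
qed

end

theorem proposition2:
  fixes L T :: "'a::chilbert_space pop"
    and P :: "'a \<Rightarrow> 'a"
    and A :: "'a pop"
    and lm lM CM :: real
    and F :: "real \<Rightarrow> 'a"
    and F0 :: 'a
  defines "P \<equiv> null_proj L"
    and "A \<equiv> A_op L T"
  assumes L: "linear_op L" "closed_op L" "hermitian_op L"
    and T: "linear_op T" "closed_op T" "antihermitian_op T"
    and TP_dense: "densely_defined (T \<circ> P)"
    and pos: "lm > 0" "lM > 0" "CM > 0"
    and micro: "\<And>x u. L x = Some u \<Longrightarrow> - Re (cinner u x) \<ge> lm * (norm (x - P x))\<^sup>2"
    and macro: "\<And>x u. T (P x) = Some u \<Longrightarrow> (norm u)\<^sup>2 \<ge> lM * (norm (P x))\<^sup>2"
    and diffusive: "\<And>x u. T (P x) = Some u \<Longrightarrow> P u = 0"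
    and bdd: "\<And>x u v. (A \<circ>\<^sub>m T) (x - P x) = Some u \<Longrightarrow> (A \<circ>\<^sub>m L) x = Some v \<Longrightarrow>
                norm u + norm v \<le> CM * norm (x - P x)"
    and sol: "solution L T F" "F 0 = F0"
  shows "(\<exists>\<delta>. is_arg_max (lambda_star lm lM CM) (\<lambda>d. 0 < d \<and> d < delta_star lm lM CM) \<delta>)
    \<and> (\<forall>\<delta>. is_arg_max (lambda_star lm lM CM) (\<lambda>d. 0 < d \<and> d < delta_star lm lM CM) \<delta> \<longrightarrow>
          (\<forall>t\<ge>0. H1 L T \<delta> (F t) \<le> H1 L T \<delta> F0 * exp (- lambda_star lm lM CM \<delta> * t)))
    \<and> (\<forall>\<delta>. 0 < \<delta> \<and> \<delta> < min 2 (delta_star lm lM CM) \<longrightarrow>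
          (\<forall>t\<ge>0. (norm (F t))\<^sup>2 \<le> C_star \<delta> * exp (- lambda_star lm lM CM \<delta> * t) * (norm F0)\<^sup>2))"
proof -
  interpret hypocoercive L T lm lM CM
    using L T TP_dense pos micro macro diffusive bdd unfolding P_def A_def
    by unfold_locales
  show ?thesis
    using lambda_star_attains_max[OF pos] solution_decay_lambda_star[OF sol(1)]
      solution_norm_decay[OF sol(1)] sol(2) by (auto simp: is_arg_max_def)
qed

end
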